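(* Let $A$ and $B$ be disjoint stationary subsets of $\omega_1$, with the subspace topology from the order topology on $\omega_1$, and give $A\times B$ the product topology. Then player 2 has a winning strategy in the proximal game on $A\times B$ with respect to any compatible uniformity on $A\times B$, but player 2 has no winning strategy in the topological proximal game $\mathrm{TP}(A\times B)$.
   Context: Entourages of a uniformity are taken to be symmetric, and $U[x]=\{y:\langle x,y\rangle\in U\}$. A uniformity on a space is compatible if it induces the given topology. Players know all previous moves in the games below. Proximal game on a uniform space $\langle X,\mathfrak{U}\rangle$: in inning $0$, player 1 chooses an entourage $U_0$ and then player 2 chooses $x_0\in X$. In inning $n+1$, player 1 chooses an entourage $U_{n+1}\subset U_n$ and then player 2 chooses $x_{n+1}\in U_n[x_n]$. Player 1 wins if either $\bigcap\{U_n[x_n]:n<\omega\}=\emptyset$ or the sequence $\{x_n:n<\omega\}$ converges in $X$; otherwise player 2 wins. Topological proximal game $\mathrm{TP}(X)$ on a topological space $X$: for an open cover $\mathcal{U}$ and $x\in X$ let $\mathrm{St}(x,\mathcal{U})=\bigcup\{U\in\mathcal{U}:x\in U\}$. In inning $n<\omega$, player 1 plays an open cover $\mathcal{U}_n$ of $X$ and then player 2 plays a point $x_n\in X$, where it is required that $x_{n+1}\in\mathrm{St}(x_n,\mathcal{U}_n)$ for each $n<\omega$. Player 1 wins if either $\{x_n:n<\omega\}$ converges in $X$ or $\bigcap\{\mathrm{St}(x_n,\mathcal{U}_n):n<\omega\}=\emptyset$; otherwise player 2 wins. *)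

theory Defs
  imports "HOL-Analysis.Analysis" "HOL-Library.Countable_Set_Type"
begin

section \<open>The space of countable ordinals\<close>

text \<open>
  The first uncountable ordinal, realised on the well-order \<open>cardSuc natLeq\<close>. The lemmas
  \<open>uncountable_omega1\<close> and \<open>countable_lessThan_omega1\<close> below characterise it up to
  order isomorphism among well-orders.
\<close>

typedef omega1 = "Field (cardSuc natLeq)"
proof -
  have "Field (cardSuc natLeq) \<noteq> {}"
    using Field_cardSuc_not_empty[OF natLeq_Card_order] .
  then show ?thesis by blast
qed

lemma Well_order_cardSuc_natLeq: "Well_order (cardSuc natLeq)"
  using cardSuc_Card_order[OF natLeq_Card_order] by (simp add: card_order_on_def)

instantiation omega1 :: wellorder
begin

definition less_eq_omega1 :: "omega1 \<Rightarrow> omega1 \<Rightarrow> bool" where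
  "x \<le> y \<longleftrightarrow> (Rep_omega1 x, Rep_omega1 y) \<in> cardSuc natLeq"

definition less_omega1 :: "omega1 \<Rightarrow> omega1 \<Rightarrow> bool" where
  "(x :: omega1) < y \<longleftrightarrow> x \<le> y \<and> x \<noteq> y"

instance
proof
  let ?r = "cardSuc natLeq"
  have lin: "Linear_order ?r" and wf: "wf (?r - Id)"
    using Well_order_cardSuc_natLeq by (auto simp: well_order_on_def)
  have refl: "Refl ?r" and trans: "trans ?r" and anti: "antisym ?r" and tot: "Total ?r"
    using lin by (auto simp: order_on_defs)
  fix x y z :: omega1
  show le_refl: "x \<le> x"
    using refl Rep_omega1[of x] by (auto simp: less_eq_omega1_def refl_on_def)
  show le_trans: "x \<le> y \<Longrightarrow> y \<le> z \<Longrightarrow> x \<le> z"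
    using trans by (auto simp: less_eq_omega1_def dest: transD)
  show le_anti: "x = y" if "x \<le> y" "y \<le> x"
  proof -
    have "Rep_omega1 x = Rep_omega1 y"
      using that anti by (auto simp: less_eq_omega1_def dest: antisymD)
    then show ?thesis by (simp add: Rep_omega1_inject)
  qed
  show "(x < y) = (x \<le> y \<and> \<not> y \<le> x)"
  proof -
    have "y \<le> x \<Longrightarrow> x \<le> y \<Longrightarrow> x = y"
      using anti by (auto simp: less_eq_omega1_def Rep_omega1_inject[symmetric] dest: antisymD)
    then show ?thesis using le_refl by (auto simp: less_omega1_def)
  qed
  show "x \<le> y \<or> y \<le> x"
    using tot le_refl Rep_omega1[of x] Rep_omega1[of y] Rep_omega1_inject[of x y]
    by (auto simp: less_eq_omega1_def total_on_def)
  show "P a" if step: "\<And>x. (\<And>y. y < x \<Longrightarrow> P y) \<Longrightarrow> P x" for P and a :: omega1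
  proof -
    have "wf (inv_image (?r - Id) Rep_omega1)" using wf by (rule wf_inv_image)
    then show ?thesis
    proof (induction a rule: wf_induct_rule)
      case (less x)
      show ?case
        by (rule step, rule less)
          (auto simp: less_omega1_def less_eq_omega1_def Rep_omega1_inject)
    qed
  qed
qed

end

instantiation omega1 :: linorder_topology
begin

definition open_omega1 :: "omega1 set \<Rightarrow> bool" where
  "(open :: omega1 set \<Rightarrow> bool) = generate_topology (range (\<lambda>a. {..<a}) \<union> range (\<lambda>a. {a<..}))"

instance
  by standard (rule open_omega1_def)

end

lemma uncountable_omega1:
  includes cardinal_syntax
  shows "uncountable (UNIV :: omega1 set)"
proof
  assume "countable (UNIV :: omega1 set)"
  then have "countable (range Rep_omega1)" by (rule countable_image)
  then have "countable (Field (cardSuc natLeq))"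
    using type_definition.Rep_range[OF type_definition_omega1] by simp
  then have "|Field (cardSuc natLeq)| \<le>o natLeq" by (simp add: countable_card_le_natLeq)
  moreover have "|Field (cardSuc natLeq)| =o cardSuc natLeq"
    by (rule card_of_Field_ordIso[OF cardSuc_Card_order[OF natLeq_Card_order]])
  ultimately have "cardSuc natLeq \<le>o natLeq"
    using ordIso_ordLeq_trans ordIso_symmetric by blast
  then show False
    using cardSuc_greater[OF natLeq_Card_order] not_ordLess_ordLeq by blast
qed

lemma countable_lessThan_omega1:
  includes cardinal_syntax
  shows "countable {..<a :: omega1}"
proof -
  let ?r = "cardSuc natLeq"
  have c: "Card_order ?r" by (rule cardSuc_Card_order[OF natLeq_Card_order])
  have "|underS ?r (Rep_omega1 a)| <o ?r" by (rule card_of_underS[OF c Rep_omega1])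
  then have "|underS ?r (Rep_omega1 a)| \<le>o natLeq"
    using cardSuc_ordLeq_ordLess[OF natLeq_Card_order card_of_Card_order] by blast
  then have "countable (underS ?r (Rep_omega1 a))" by (simp add: countable_card_le_natLeq)
  moreover have "Rep_omega1 ` {..<a} \<subseteq> underS ?r (Rep_omega1 a)"
    by (auto simp: underS_def less_omega1_def less_eq_omega1_def Rep_omega1_inject)
  ultimately have "countable (Rep_omega1 ` {..<a})" using countable_subset by blast
  moreover have "inj_on Rep_omega1 {..<a}" by (simp add: inj_on_def Rep_omega1_inject)
  ultimately show ?thesis by (rule countable_image_inj_on)
qed

definition club :: "omega1 set \<Rightarrow> bool" where
  "club C \<longleftrightarrow> closed C \<and> (\<forall>a. \<exists>c\<in>C. a < c)"

definition stationary :: "omega1 set \<Rightarrow> bool" where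
  "stationary S \<longleftrightarrow> (\<forall>C. club C \<longrightarrow> S \<inter> C \<noteq> {})"

section \<open>Uniformities on a carrier set\<close>

definition is_uniformity :: "'a set \<Rightarrow> ('a \<times> 'a) set set \<Rightarrow> bool" where
  "is_uniformity X \<UU> \<longleftrightarrow>
     \<UU> \<noteq> {} \<and>
     (\<forall>U\<in>\<UU>. Id_on X \<subseteq> U \<and> U \<subseteq> X \<times> X) \<and>
     (\<forall>U\<in>\<UU>. \<forall>V. U \<subseteq> V \<and> V \<subseteq> X \<times> X \<longrightarrow> V \<in> \<UU>) \<and>
     (\<forall>U\<in>\<UU>. \<forall>V\<in>\<UU>. U \<inter> V \<in> \<UU>) \<and>
     (\<forall>U\<in>\<UU>. U\<inverse> \<in> \<UU>) \<and>
     (\<forall>U\<in>\<UU>. \<exists>V\<in>\<UU>. V O V \<subseteq> U)"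

text \<open>
  A uniformity as above also has non-symmetric members; only the symmetric ones (which form a
  base) count as entourages and are available as moves in the proximal game.
\<close>

definition entourage :: "('a \<times> 'a) set set \<Rightarrow> ('a \<times> 'a) set \<Rightarrow> bool" where
  "entourage \<UU> U \<longleftrightarrow> U \<in> \<UU> \<and> sym U"

definition uniform_topology :: "'a set \<Rightarrow> ('a \<times> 'a) set set \<Rightarrow> 'a topology" where
  "uniform_topology X \<UU> =
     topology (\<lambda>S. S \<subseteq> X \<and> (\<forall>x\<in>S. \<exists>U. entourage \<UU> U \<and> U `` {x} \<subseteq> S))"

lemma openin_uniform_topology:
  assumes "is_uniformity X \<UU>"
  shows "openin (uniform_topology X \<UU>) S \<longleftrightarrow>
           S \<subseteq> X \<and> (\<forall>x\<in>S. \<exists>U. entourage \<UU> U \<and> U `` {x} \<subseteq> S)"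
proof -
  have int: "entourage \<UU> (U \<inter> V)" if "entourage \<UU> U" "entourage \<UU> V" for U V
    using that assms by (auto simp: entourage_def is_uniformity_def sym_Int)
  have "istopology (\<lambda>S. S \<subseteq> X \<and> (\<forall>x\<in>S. \<exists>U. entourage \<UU> U \<and> U `` {x} \<subseteq> S))"
    unfolding istopology_def
  proof (intro conjI allI impI ballI)
    fix S T x
    assume S: "S \<subseteq> X \<and> (\<forall>x\<in>S. \<exists>U. entourage \<UU> U \<and> U `` {x} \<subseteq> S)"
      and T: "T \<subseteq> X \<and> (\<forall>x\<in>T. \<exists>U. entourage \<UU> U \<and> U `` {x} \<subseteq> T)"
    show "S \<inter> T \<subseteq> X" using S by blast
    assume "x \<in> S \<inter> T"
    then obtain U V where "entourage \<UU> U" "U `` {x} \<subseteq> S" "entourage \<UU> V" "V `` {x} \<subseteq> T"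
      using S T by blast
    then show "\<exists>U. entourage \<UU> U \<and> U `` {x} \<subseteq> S \<inter> T"
      by (intro exI[of _ "U \<inter> V"]) (use int in blast)
  next
    fix \<K>
    assume K: "\<forall>S\<in>\<K>. S \<subseteq> X \<and> (\<forall>x\<in>S. \<exists>U. entourage \<UU> U \<and> U `` {x} \<subseteq> S)"
    show "\<Union>\<K> \<subseteq> X" using K by blast
    fix x assume "x \<in> \<Union>\<K>"
    then show "\<exists>U. entourage \<UU> U \<and> U `` {x} \<subseteq> \<Union>\<K>"
      using K by (meson Union_iff Union_upper subset_trans)
  qed
  then show ?thesis
    unfolding uniform_topology_def by (simp add: topology_inverse')
qed

definition compatible_uniformity :: "'a topology \<Rightarrow> ('a \<times> 'a) set set \<Rightarrow> bool" where
  "compatible_uniformity T \<UU> \<longleftrightarrow>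
     is_uniformity (topspace T) \<UU> \<and> uniform_topology (topspace T) \<UU> = T"

section \<open>The games\<close>

text \<open>
  A strategy of player 2 maps the moves of player 1 up to and including the current inning, and
  the previous moves of player 2, to the next point. In both games below player 1 has a legal
  move at every position (repeating the last move) and the legality of player 1's moves does not
  depend on player 2's, so every position reached against legal moves lies on an infinite run
  against legal moves. Hence it suffices to quantify over infinite runs, requiring that player 2
  always obeys the rules and wins.
\<close>

definition run_of_strategy2 ::
    "('m list \<Rightarrow> 'a list \<Rightarrow> 'a) \<Rightarrow> (nat \<Rightarrow> 'm) \<Rightarrow> (nat \<Rightarrow> 'a) \<Rightarrow> bool" where
  "run_of_strategy2 \<sigma> m x \<longleftrightarrow> (\<forall>n. x n = \<sigma> (map m [0..<Suc n]) (map x [0..<n]))"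

definition converges_in :: "'a topology \<Rightarrow> (nat \<Rightarrow> 'a) \<Rightarrow> bool" where
  "converges_in T x \<longleftrightarrow> (\<exists>l. limitin T x l sequentially)"

definition proximal_legal1 :: "('a \<times> 'a) set set \<Rightarrow> (nat \<Rightarrow> ('a \<times> 'a) set) \<Rightarrow> bool" where
  "proximal_legal1 \<UU> U \<longleftrightarrow> (\<forall>n. entourage \<UU> (U n)) \<and> (\<forall>n. U (Suc n) \<subseteq> U n)"

definition proximal_legal2 ::
    "'a set \<Rightarrow> (nat \<Rightarrow> ('a \<times> 'a) set) \<Rightarrow> (nat \<Rightarrow> 'a) \<Rightarrow> bool" where
  "proximal_legal2 X U x \<longleftrightarrow> (\<forall>n. x n \<in> X) \<and> (\<forall>n. x (Suc n) \<in> U n `` {x n})"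

definition proximal_win1 ::
    "'a set \<Rightarrow> ('a \<times> 'a) set set \<Rightarrow> (nat \<Rightarrow> ('a \<times> 'a) set) \<Rightarrow> (nat \<Rightarrow> 'a) \<Rightarrow> bool" where
  "proximal_win1 X \<UU> U x \<longleftrightarrow>
     (\<Inter>n. U n `` {x n}) = {} \<or> converges_in (uniform_topology X \<UU>) x"

definition proximal_player2_has_winning_strategy :: "'a set \<Rightarrow> ('a \<times> 'a) set set \<Rightarrow> bool" where
  "proximal_player2_has_winning_strategy X \<UU> \<longleftrightarrow>
     (\<exists>\<sigma>. \<forall>U x. proximal_legal1 \<UU> U \<and> run_of_strategy2 \<sigma> U x \<longrightarrow>
        proximal_legal2 X U x \<and> \<not> proximal_win1 X \<UU> U x)"

definition open_cover :: "'a topology \<Rightarrow> 'a set set \<Rightarrow> bool" where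
  "open_cover T \<C> \<longleftrightarrow> (\<forall>C\<in>\<C>. openin T C) \<and> \<Union>\<C> = topspace T"

definition St :: "'a \<Rightarrow> 'a set set \<Rightarrow> 'a set" where
  "St x \<C> = \<Union>{C \<in> \<C>. x \<in> C}"

definition TP_legal1 :: "'a topology \<Rightarrow> (nat \<Rightarrow> 'a set set) \<Rightarrow> bool" where
  "TP_legal1 T \<C> \<longleftrightarrow> (\<forall>n. open_cover T (\<C> n))"

definition TP_legal2 :: "'a topology \<Rightarrow> (nat \<Rightarrow> 'a set set) \<Rightarrow> (nat \<Rightarrow> 'a) \<Rightarrow> bool" where
  "TP_legal2 T \<C> x \<longleftrightarrow> (\<forall>n. x n \<in> topspace T) \<and> (\<forall>n. x (Suc n) \<in> St (x n) (\<C> n))"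

definition TP_win1 :: "'a topology \<Rightarrow> (nat \<Rightarrow> 'a set set) \<Rightarrow> (nat \<Rightarrow> 'a) \<Rightarrow> bool" where
  "TP_win1 T \<C> x \<longleftrightarrow> converges_in T x \<or> (\<Inter>n. St (x n) (\<C> n)) = {}"

definition TP_player2_has_winning_strategy :: "'a topology \<Rightarrow> bool" where
  "TP_player2_has_winning_strategy T \<longleftrightarrow>
     (\<exists>\<sigma>. \<forall>\<C> x. TP_legal1 T \<C> \<and> run_of_strategy2 \<sigma> \<C> x \<longrightarrow>
        TP_legal2 T \<C> x \<and> \<not> TP_win1 T \<C> x)"

end

theory Submission
  imports Defs
begin

text \<open>
  Both halves rest on one property of a stationary set \<open>S\<close>: for every function \<open>h\<close> on
  \<open>\<omega>\<^sub>1\<close> there are arbitrarily large members of \<open>S\<close> that are closed under \<open>h\<close>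
  (\<open>stationary_closure_point\<close>). It yields the form of the pressing-down lemma used below: a
  function regressive on \<open>S\<close> is constant on an unbounded subset of \<open>S\<close>.

  In the proximal game, pressing down shows that every entourage \<open>U\<close> of a compatible uniformity
  has a large corner (\<open>entourage_corner\<close>): there are \<open>\<alpha>\<close> and \<open>\<beta>\<close> such that any two
  points \<open>(a, b)\<close> with \<open>\<alpha> < a\<close> and \<open>\<beta> a < b\<close> are \<open>U\<close>-close. Player 2
  chooses points in the corners of all entourages played so far, in such a way that
  \<open>a\<^sub>0 < b\<^sub>0 < a\<^sub>1 < b\<^sub>1 < \<dots>\<close>. A limit would have equal coordinates, which is
  impossible as \<open>A\<close> and \<open>B\<close> are disjoint; and a point lying in the corners of all countably
  many entourages is close to every \<open>x\<^sub>n\<close>.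

  In the topological game, fix a strategy of player 2. For a finite set \<open>F\<close> of ordinals, let
  player 1 use covers by open rectangles whose sides are not split by any \<open>{..\<gamma>}\<close> with
  \<open>\<gamma> \<in> F\<close>, and which lie entirely in \<open>a < b\<close> or entirely in \<open>b < a\<close>. The first
  answer of player 2 decides between the two regions. Choose \<open>\<delta>\<close> closed under the
  strategy, in \<open>B\<close> in the first case and in \<open>A\<close> in the second, and let player 1 enumerate the
  ordinals below \<open>\<delta>\<close>. If \<open>(u, v)\<close> lies in all stars, then the coordinates of player 2's
  points converge to \<open>min u \<delta>\<close> and \<open>min v \<delta>\<close> (\<open>tendsto_of_separation\<close>). In the first
  case \<open>u < \<delta>\<close>, so these limits lie in \<open>A\<close> and in \<open>B\<close>; the second case is symmetric.
\<close>

section \<open>Stationary sets and regressive functions\<close>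

lemma omega1_countable_bounded:
  fixes S :: "omega1 set"
  assumes "countable S"
  shows "\<exists>c. \<forall>x\<in>S. x < c"
proof (rule ccontr)
  assume "\<nexists>c. \<forall>x\<in>S. x < c"
  then have "(UNIV :: omega1 set) = (\<Union>x\<in>S. insert x {..<x})"
    by (force simp: not_less le_less)
  moreover have "countable (\<Union>x\<in>S. insert x {..<x})"
    using assms countable_lessThan_omega1 by blast
  ultimately show False using uncountable_omega1 by simp
qed

lemma countable_atMost_omega1: "countable {..a :: omega1}"
proof -
  have "{..a} = insert a {..<a}" by (auto simp: le_less)
  then show ?thesis by (simp add: countable_lessThan_omega1)
qed

lemma open_atMost_omega1: "open {..a :: omega1}"
proof -
  obtain b where b: "a < b" using omega1_countable_bounded[of "{a}"] by auto
  define s where "s = (LEAST x. a < x)"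
  have "a < s" unfolding s_def by (rule LeastI[of _ b]) (rule b)
  moreover have "s \<le> x" if "a < x" for x unfolding s_def by (rule Least_le) (rule that)
  ultimately have "{..a} = {..<s}" by (force simp: not_less[symmetric])
  then show ?thesis by simp
qed

lemma club_closure_points:
  fixes h :: "omega1 \<Rightarrow> omega1"
  shows "club {d. c < d \<and> (\<forall>g<d. h g < d)}"
  unfolding club_def
proof (intro conjI allI)
  \<comment> \<open>If \<open>g < d \<le> h g\<close>, then all points of the open set \<open>{g<..} \<inter> {..h g}\<close> fail to be closed under \<open>h\<close>.\<close>
  have "- {d. c < d \<and> (\<forall>g<d. h g < d)} = {..c} \<union> (\<Union>g. {g<..} \<inter> {..h g})"
    by (intro set_eqI, simp only: Compl_iff mem_Collect_eq Un_iff UN_iff Int_iff greaterThan_iff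
        atMost_iff de_Morgan_conj not_all not_imp not_less) blast
  moreover have "open \<dots>" by (intro open_Un open_UN open_Int ballI open_atMost_omega1 open_greaterThan)
  ultimately show "closed {d. c < d \<and> (\<forall>g<d. h g < d)}" by (simp add: closed_def)
next
  fix a
  have "\<exists>s. \<forall>x\<in>insert y (h ` insert y {..<y}). x < s" for y
    by (rule omega1_countable_bounded) (simp add: countable_lessThan_omega1)
  then obtain s where "\<forall>y. \<forall>x\<in>insert y (h ` insert y {..<y}). x < s y" by metis
  then have s: "y < s y" "g \<le> y \<Longrightarrow> h g < s y" for g y by (auto simp: le_less)
  obtain e where e: "a < e" "c < e" using omega1_countable_bounded[of "{a, c}"] by auto
  \<comment> \<open>The supremum of the iterates of \<open>s\<close> is closed under \<open>h\<close>.\<close>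
  define t where "t n = (s ^^ n) e" for n
  have tS: "t (Suc n) = s (t n)" for n by (simp add: t_def)
  have t_less: "t n < t (Suc n)" for n using s(1)[of "t n"] by (simp add: tS)
  obtain b where b: "\<forall>x\<in>range t. x < b" using omega1_countable_bounded[of "range t"] by auto
  define d where "d = (LEAST x. \<forall>n. t n < x)"
  have td: "t n < d" for n
    unfolding d_def by (rule LeastI2[of _ b]) (use b in auto)
  have reach: "\<exists>n. g < t n" if "g < d" for g
  proof -
    have "\<not> (\<forall>n. t n < g)"
      using not_less_Least[of g "\<lambda>x. \<forall>n. t n < x"] that unfolding d_def by simp
    then obtain n where "g \<le> t n" by (auto simp: not_less)
    then show ?thesis using t_less[of n] by (meson le_less_trans)
  qed
  have "h g < d" if g: "g < d" for g
  proof -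
    obtain n where "g < t n" using reach[OF g] by blast
    then have "h g < t (Suc n)" using s(2)[of g "t n"] by (simp add: tS)
    then show ?thesis using td less_trans by blast
  qed
  moreover have "e < d" using td[of 0] by (simp add: t_def)
  ultimately show "\<exists>d\<in>{d. c < d \<and> (\<forall>g<d. h g < d)}. a < d" using e by (intro bexI[of _ d]) auto
qed

text \<open>A stationary set contains ordinals beyond \<open>c\<close> that are closed under \<open>h\<close>.\<close>

lemma stationary_closure_point:
  assumes "stationary S"
  obtains d where "d \<in> S" "c < d" "\<And>g. g < d \<Longrightarrow> h g < d"
  using assms club_closure_points[of c h] unfolding stationary_def by blast

lemma stationary_unbounded:
  assumes "stationary S"
  obtains d where "d \<in> S" "c < d"
  using stationary_closure_point[OF assms, of c id] by blast

text \<open>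
  A weak form of Fodor's lemma: the fibre is only claimed to be unbounded, not stationary. If every
  fibre over \<open>a\<close> were bounded by \<open>h a\<close>, then a member of \<open>S\<close> closed under \<open>h\<close> would
  give a contradiction.
\<close>

lemma pressing_down:
  assumes S: "stationary S" and f: "\<And>x. x \<in> S \<Longrightarrow> c < x \<Longrightarrow> f x < x"
  obtains a where "\<And>y. \<exists>x\<in>S. y < x \<and> f x = a"
proof -
  have "\<exists>a. \<forall>y. \<exists>x\<in>S. y < x \<and> f x = a"
  proof (rule ccontr)
    assume "\<not> ?thesis"
    then obtain h where h: "\<And>a x. x \<in> S \<Longrightarrow> h a < x \<Longrightarrow> f x \<noteq> a" by metis
    obtain d where "d \<in> S" "c < d" "\<And>g. g < d \<Longrightarrow> h g < d"
      using stationary_closure_point[OF S, of c h] by blast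
    then show False using f h by blast
  qed
  then show ?thesis using that by blast
qed

section \<open>Entourages of a product of stationary sets\<close>

lemma entourage_halve:
  assumes u: "is_uniformity X \<UU>" and U: "entourage \<UU> U"
  shows "\<exists>V. entourage \<UU> V \<and> V O V \<subseteq> U \<and> V \<subseteq> U"
proof -
  obtain W where W: "W \<in> \<UU>" "W O W \<subseteq> U"
    using u U unfolding is_uniformity_def entourage_def by meson
  have "W \<inter> W\<inverse> \<in> \<UU>" using u W unfolding is_uniformity_def by meson
  then have e: "entourage \<UU> (W \<inter> W\<inverse>)" by (auto simp: entourage_def sym_def)
  have "Id_on X \<subseteq> W" "W \<subseteq> X \<times> X" using u W unfolding is_uniformity_def by blast+
  then have "W \<subseteq> W O W" by fastforce
  then show ?thesis using e W by blast
qed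

text \<open>
  The set \<open>V `` {x}\<close> need not be open itself; its interior consists of the points \<open>y\<close> with
  \<open>W `` {y} \<subseteq> V `` {x}\<close> for some entourage \<open>W\<close>.
\<close>

lemma entourage_neighbourhood:
  assumes c: "compatible_uniformity T \<UU>" and V: "entourage \<UU> V" and x: "x \<in> topspace T"
  obtains G where "openin T G" "x \<in> G" "G \<subseteq> V `` {x}"
proof -
  let ?X = "topspace T"
  let ?G = "{y \<in> ?X. \<exists>W. entourage \<UU> W \<and> W `` {y} \<subseteq> V `` {x}}"
  have u: "is_uniformity ?X \<UU>" and t: "uniform_topology ?X \<UU> = T"
    using c unfolding compatible_uniformity_def by iprover+
  have ent: "Id_on ?X \<subseteq> W \<and> W \<subseteq> ?X \<times> ?X" if "entourage \<UU> W" for W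
    using u that by (simp add: is_uniformity_def entourage_def)
  have "\<exists>W. entourage \<UU> W \<and> W `` {y} \<subseteq> ?G" if y: "y \<in> ?G" for y
  proof -
    obtain W where W: "entourage \<UU> W" "W `` {y} \<subseteq> V `` {x}" using y by blast
    obtain W' where W': "entourage \<UU> W'" "W' O W' \<subseteq> W" using entourage_halve[OF u W(1)] by blast
    have "W' `` {y} \<subseteq> ?G"
    proof
      fix z assume z: "z \<in> W' `` {y}"
      then have "W' `` {z} \<subseteq> V `` {x}" using W W' by blast
      moreover have "z \<in> ?X" using z ent[OF W'(1)] by blast
      ultimately show "z \<in> ?G" using W' by blast
    qed
    then show ?thesis using W' by blast
  qed
  moreover have "?G \<subseteq> ?X" by blast
  ultimately have "openin T ?G"
    unfolding openin_uniform_topology[OF u, unfolded t] by blast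
  moreover have "?G \<subseteq> V `` {x}" using ent by blast
  moreover have "x \<in> ?G" using x V by blast
  ultimately show ?thesis using that[of ?G] by blast
qed

text \<open>The topology of the product of the subspaces \<open>A\<close> and \<open>B\<close> of \<open>\<omega>\<^sub>1\<close>.\<close>

abbreviation rect_top :: "omega1 set \<Rightarrow> omega1 set \<Rightarrow> (omega1 \<times> omega1) topology" where
  "rect_top A B \<equiv> prod_topology (subtopology euclidean A) (subtopology euclidean B)"

lemma entourage_rectangle:
  assumes c: "compatible_uniformity (rect_top A B) \<UU>" and V: "entourage \<UU> V"
    and ab: "a \<in> A" "b \<in> B"
  shows "\<exists>P Q. open P \<and> open Q \<and> a \<in> P \<and> b \<in> Q \<and>
    (\<forall>a'\<in>P \<inter> A. \<forall>b'\<in>Q \<inter> B. ((a, b), (a', b')) \<in> V)"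
proof -
  have "(a, b) \<in> topspace (rect_top A B)" using ab by simp
  from entourage_neighbourhood[OF c V this]
  obtain G where G: "openin (rect_top A B) G" "(a, b) \<in> G" "G \<subseteq> V `` {(a, b)}" .
  then obtain P Q where PQ: "openin (subtopology euclidean A) P" "openin (subtopology euclidean B) Q"
    "a \<in> P" "b \<in> Q" "P \<times> Q \<subseteq> G"
    unfolding openin_prod_topology_alt by meson
  then obtain P' Q' where P': "open P'" "P = P' \<inter> A" and Q': "open Q'" "Q = Q' \<inter> B"
    by (auto simp: openin_open)
  have "((a, b), (a', b')) \<in> V" if "a' \<in> P' \<inter> A" "b' \<in> Q' \<inter> B" for a' b'
  proof -
    have "(a', b') \<in> P \<times> Q" using that P' Q' by simp
    then have "(a', b') \<in> V `` {(a, b)}" using PQ(5) G(3) by (meson subsetD)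
    then show ?thesis by simp
  qed
  moreover have "a \<in> P'" "b \<in> Q'" using PQ P' Q' by simp_all
  ultimately show ?thesis using P'(1) Q'(1) by (intro exI[of _ P'] exI[of _ Q']) simp
qed

text \<open>
  Far out on a column \<open>{a} \<times> B\<close> all points are close: by pressing down, the intervals
  \<open>{f b<..b}\<close> of points close to \<open>(a, b)\<close> have a common left end for unboundedly many \<open>b\<close>.
\<close>

lemma entourage_column:
  assumes c: "compatible_uniformity (rect_top A B) \<UU>" and B: "stationary B"
    and U: "entourage \<UU> U" and a: "a \<in> A"
  shows "\<exists>d. \<forall>b\<in>B. \<forall>b'\<in>B. d < b \<longrightarrow> d < b' \<longrightarrow> ((a, b), (a, b')) \<in> U"
proof -
  have u: "is_uniformity (A \<times> B) \<UU>" using c by (simp add: compatible_uniformity_def)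
  obtain V where V: "entourage \<UU> V" "V O V \<subseteq> U" using entourage_halve[OF u U] by blast
  have "\<exists>e<b. \<forall>b'\<in>B. e < b' \<longrightarrow> b' \<le> b \<longrightarrow> ((a, b), (a, b')) \<in> V" if b: "b \<in> B" "z < b" for b z
  proof -
    obtain P Q where PQ: "open Q" "a \<in> P" "b \<in> Q"
      "\<forall>a'\<in>P \<inter> A. \<forall>b'\<in>Q \<inter> B. ((a, b), (a', b')) \<in> V"
      using entourage_rectangle[OF c V(1) a b(1)] by blast
    obtain e where "e < b" "{e<..b} \<subseteq> Q" using open_left[OF PQ(1,3) b(2)] by blast
    then show ?thesis using PQ a by (intro exI[of _ e]) auto
  qed
  \<comment> \<open>The value \<open>undefined\<close> serves as an arbitrary fixed ordinal; only \<open>b\<close> beyond it are considered.\<close>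
  then obtain f where f: "\<And>b. b \<in> B \<Longrightarrow> undefined < b \<Longrightarrow> f b < b"
    "\<And>b b'. b \<in> B \<Longrightarrow> undefined < b \<Longrightarrow> b' \<in> B \<Longrightarrow> f b < b' \<Longrightarrow> b' \<le> b \<Longrightarrow> ((a, b), (a, b')) \<in> V"
    by metis
  obtain d where d: "\<And>y. \<exists>x\<in>B. y < x \<and> f x = d" using pressing_down[OF B f(1)] by blast
  have "((a, b), (a, b')) \<in> U" if "b \<in> B" "b' \<in> B" "d < b" "d < b'" for b b'
  proof -
    obtain x where x: "x \<in> B" "max undefined (max b b') < x" "f x = d" using d by blast
    then have "((a, x), (a, b)) \<in> V" "((a, x), (a, b')) \<in> V" using f(2)[of x] that by auto
    moreover have "sym V" using V by (simp add: entourage_def)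
    ultimately show ?thesis using V by (meson relcomp.relcompI subsetD symD)
  qed
  then show ?thesis by blast
qed

text \<open>
  The bound \<open>\<beta> a\<close> comes from the column over \<open>a\<close>. Moving from \<open>a\<close> to a nearby
  \<open>a'\<close> is possible at each height \<open>x \<in> B\<close>, with a left end \<open>f x < a\<close> that may depend on
  \<open>x\<close>; pressing down along \<open>B\<close> gives one left end \<open>e\<close> that works at unboundedly many
  heights, so that the columns over \<open>a\<close> and \<open>a'\<close> can be joined at such a height. Pressing
  down along \<open>A\<close> then makes the left end independent of \<open>a\<close>.
\<close>

lemma entourage_corner:
  assumes c: "compatible_uniformity (rect_top A B) \<UU>" and A: "stationary A" and B: "stationary B"
    and U: "entourage \<UU> U"
  shows "\<exists>\<alpha> \<beta>. \<forall>a\<in>A. \<forall>a'\<in>A. \<forall>b\<in>B. \<forall>b'\<in>B. \<alpha> < a \<longrightarrow> \<alpha> < a' \<longrightarrow> \<beta> a < b \<longrightarrow> \<beta> a' < b' \<longrightarrow>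
    ((a, b), (a', b')) \<in> U"
proof -
  have u: "is_uniformity (A \<times> B) \<UU>" using c by (simp add: compatible_uniformity_def)
  obtain V1 where V1: "entourage \<UU> V1" "V1 O V1 \<subseteq> U" using entourage_halve[OF u U] by blast
  obtain V2 where V2: "entourage \<UU> V2" "V2 O V2 \<subseteq> V1" using entourage_halve[OF u V1(1)] by blast
  obtain V where V: "entourage \<UU> V" "V O V \<subseteq> V2" "V \<subseteq> V2" using entourage_halve[OF u V2(1)] by blast
  obtain \<beta> where \<beta>: "\<And>a b b'. a \<in> A \<Longrightarrow> b \<in> B \<Longrightarrow> b' \<in> B \<Longrightarrow> \<beta> a < b \<Longrightarrow> \<beta> a < b' \<Longrightarrow>
      ((a, b), (a, b')) \<in> V"
    using entourage_column[OF c B V(1)] by metis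
  have "\<exists>e<a. \<forall>a'\<in>A. e < a' \<longrightarrow> a' \<le> a \<longrightarrow> (\<forall>b\<in>B. \<forall>b'\<in>B. \<beta> a < b \<longrightarrow> \<beta> a' < b' \<longrightarrow>
      ((a, b), (a', b')) \<in> V1)" if a: "a \<in> A" "z < a" for a z
  proof -
    have "\<exists>e<a. \<forall>a'\<in>A. e < a' \<longrightarrow> a' \<le> a \<longrightarrow> ((a, b), (a', b)) \<in> V" if b: "b \<in> B" for b
    proof -
      obtain P Q where PQ: "open P" "a \<in> P" "b \<in> Q"
        "\<forall>a'\<in>P \<inter> A. \<forall>b'\<in>Q \<inter> B. ((a, b), (a', b')) \<in> V"
        using entourage_rectangle[OF c V(1) a(1) b] by blast
      obtain e where "e < a" "{e<..a} \<subseteq> P" using open_left[OF PQ(1,2) a(2)] by blast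
      then show ?thesis using PQ b by (intro exI[of _ e]) auto
    qed
    then obtain f where f: "\<And>b. b \<in> B \<Longrightarrow> f b < a"
      "\<And>b a'. b \<in> B \<Longrightarrow> a' \<in> A \<Longrightarrow> f b < a' \<Longrightarrow> a' \<le> a \<Longrightarrow> ((a, b), (a', b)) \<in> V" by metis
    have "f b < b" if "b \<in> B" "a < b" for b using f(1)[OF that(1)] that by simp
    then obtain e where e: "\<And>y. \<exists>x\<in>B. y < x \<and> f x = e" using pressing_down[OF B] by blast
    have "e < a" using e f(1) by blast
    moreover have "((a, b), (a', b')) \<in> V1"
      if h: "a' \<in> A" "e < a'" "a' \<le> a" "b \<in> B" "b' \<in> B" "\<beta> a < b" "\<beta> a' < b'" for a' b b'
    proof -
      obtain x where x: "x \<in> B" "max (\<beta> a) (\<beta> a') < x" "f x = e" using e by blast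
      have "((a, b), (a, x)) \<in> V" "((a, x), (a', x)) \<in> V" "((a', x), (a', b')) \<in> V"
        using x h \<beta> f a by auto
      then show ?thesis using V V2 by blast
    qed
    ultimately show ?thesis by blast
  qed
  then obtain f where f: "\<And>a. a \<in> A \<Longrightarrow> undefined < a \<Longrightarrow> f a < a"
    "\<And>a a' b b'. a \<in> A \<Longrightarrow> undefined < a \<Longrightarrow> a' \<in> A \<Longrightarrow> f a < a' \<Longrightarrow> a' \<le> a \<Longrightarrow> b \<in> B \<Longrightarrow> b' \<in> B \<Longrightarrow>
      \<beta> a < b \<Longrightarrow> \<beta> a' < b' \<Longrightarrow> ((a, b), (a', b')) \<in> V1"
    by metis
  obtain \<alpha> where \<alpha>: "\<And>y. \<exists>x\<in>A. y < x \<and> f x = \<alpha>" using pressing_down[OF A f(1)] by blast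
  have "((a, b), (a', b')) \<in> U" if h: "a \<in> A" "a' \<in> A" "b \<in> B" "b' \<in> B" "\<alpha> < a" "\<alpha> < a'" "\<beta> a < b" "\<beta> a' < b'"
    for a a' b b'
  proof -
    obtain x where x: "x \<in> A" "max undefined (max a a') < x" "f x = \<alpha>" using \<alpha> by blast
    obtain y where y: "y \<in> B" "\<beta> x < y" using stationary_unbounded[OF B] by blast
    have "((x, y), (a, b)) \<in> V1" "((x, y), (a', b')) \<in> V1" using f(2)[of x] x y h by auto
    moreover have "sym V1" using V1 by (simp add: entourage_def)
    ultimately show ?thesis using V1 by (meson relcomp.relcompI subsetD symD)
  qed
  then show ?thesis by blast
qed

section \<open>Player 2 wins the proximal game\<close>

lemma limitin_rect_top:
  "limitin (rect_top A B) x l sequentially \<Longrightarrow>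
    fst l \<in> A \<and> snd l \<in> B \<and> (fst \<circ> x) \<longlonglongrightarrow> fst l \<and> (snd \<circ> x) \<longlonglongrightarrow> snd l"
  unfolding limitin_pairwise limitin_subtopology by (simp add: prod.case_eq_if)

lemma interleaved_not_convergent:
  assumes disj: "A \<inter> B = {}"
    and x: "\<And>n. fst (x n) < snd (x n)" "\<And>n. snd (x n) < fst (x (Suc n))"
  shows "\<not> converges_in (rect_top A B) x"
proof
  assume "converges_in (rect_top A B) x"
  then obtain l where "limitin (rect_top A B) x l sequentially" unfolding converges_in_def ..
  note l = limitin_rect_top[OF this]
  have "(\<lambda>n. fst (x (Suc n))) \<longlonglongrightarrow> fst l" using l LIMSEQ_Suc[of "fst \<circ> x"] by (simp add: o_def)
  then have "(\<lambda>n. snd (x n)) \<longlonglongrightarrow> fst l"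
    by (rule tendsto_sandwich[rotated 3, where f = "\<lambda>n. fst (x n)"])
      (use l x in \<open>auto simp: o_def intro!: always_eventually less_imp_le\<close>)
  then have "fst l = snd l" using l LIMSEQ_unique[of "snd \<circ> x"] by (auto simp: o_def)
  then show False using l disj by auto
qed

lemma proximal_player2_wins:
  assumes A: "stationary A" and B: "stationary B" and disj: "A \<inter> B = {}"
    and c: "compatible_uniformity (rect_top A B) \<UU>"
  shows "proximal_player2_has_winning_strategy (A \<times> B) \<UU>"
proof -
  have ut: "uniform_topology (A \<times> B) \<UU> = rect_top A B"
    using c by (simp add: compatible_uniformity_def)
  \<comment> \<open>Choose corners \<open>\<alpha> U\<close>, \<open>\<beta> U\<close> for all entourages \<open>U\<close> at once.\<close>
  obtain \<alpha> \<beta> where ab: "\<And>U a a' b b'. entourage \<UU> U \<Longrightarrow> a \<in> A \<Longrightarrow> a' \<in> A \<Longrightarrow> b \<in> B \<Longrightarrow> b' \<in> B \<Longrightarrow>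
      \<alpha> U < a \<Longrightarrow> \<alpha> U < a' \<Longrightarrow> \<beta> U a < b \<Longrightarrow> \<beta> U a' < b' \<Longrightarrow> ((a, b), (a', b')) \<in> U"
    using entourage_corner[OF c A B] by metis
  define good where "good M Y p \<longleftrightarrow> p \<in> A \<times> B \<and> (\<forall>q\<in>Y. snd q < fst p) \<and> fst p < snd p \<and>
      (\<forall>U\<in>M. \<alpha> U < fst p \<and> \<beta> U (fst p) < snd p)"
    for M and Y :: "(omega1 \<times> omega1) set" and p :: "omega1 \<times> omega1"
  have ex: "\<exists>p. good M Y p"
    if "countable M" "countable Y" for M and Y :: "(omega1 \<times> omega1) set"
  proof -
    have "countable (\<alpha> ` M \<union> snd ` Y)" using that by auto
    then obtain s where s: "\<And>y. y \<in> \<alpha> ` M \<union> snd ` Y \<Longrightarrow> y < s"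
      using omega1_countable_bounded by metis
    obtain a where a: "a \<in> A" "s < a" using stationary_unbounded[OF A] by blast
    have "countable (insert a ((\<lambda>U. \<beta> U a) ` M))" using that by auto
    then obtain t where t: "\<And>y. y \<in> insert a ((\<lambda>U. \<beta> U a) ` M) \<Longrightarrow> y < t"
      using omega1_countable_bounded by metis
    obtain b where b: "b \<in> B" "t < b" using stationary_unbounded[OF B] by blast
    have "(\<forall>q\<in>Y. snd q < a) \<and> a < b \<and> (\<forall>U\<in>M. \<alpha> U < a \<and> \<beta> U a < b)"
      using s t a(2) b(2) by (meson UnI1 UnI2 imageI insertI1 insertI2 less_trans)
    then show ?thesis using a b unfolding good_def by (intro exI[of _ "(a, b)"]) auto
  qed
  define \<sigma> where "\<sigma> ms xs = (SOME p. good (set ms) (set xs) p)" for ms and xs :: "(omega1 \<times> omega1) list"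
  have \<sigma>: "good (set ms) (set xs) (\<sigma> ms xs)" for ms xs
    unfolding \<sigma>_def by (rule someI_ex, rule ex) (simp_all add: countable_finite)
  have "proximal_legal2 (A \<times> B) U x \<and> \<not> proximal_win1 (A \<times> B) \<UU> U x"
    if legal: "proximal_legal1 \<UU> U" and run: "run_of_strategy2 \<sigma> U x" for U x
  proof -
    have e: "entourage \<UU> (U n)" for n using legal by (simp add: proximal_legal1_def)
    have good: "good (U ` {..n}) (x ` {..<n}) (x n)" for n
    proof -
      have "x n = \<sigma> (map U [0..<Suc n]) (map x [0..<n])"
        using run unfolding run_of_strategy2_def by blast
      then have "good (set (map U [0..<Suc n])) (set (map x [0..<n])) (x n)" using \<sigma> by metis
      then show ?thesis by (simp add: atLeast0LessThan lessThan_Suc_atMost del: upt_Suc)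
    qed
    have close: "(x n, p) \<in> U n" if "good (U ` {..m}) Y p" "n \<le> m" for n m Y p
      using ab[OF e, of "fst (x n)" "fst p" "snd (x n)" "snd p" n] good[of n] that
      unfolding good_def by auto
    have "(x n, x (Suc n)) \<in> U n" for n using close good[of "Suc n"] by (meson le_SucI order_refl)
    moreover have "x n \<in> A \<times> B" for n using good[of n] unfolding good_def by blast
    ultimately have "proximal_legal2 (A \<times> B) U x" by (auto simp: proximal_legal2_def)
    moreover have "\<not> converges_in (rect_top A B) x"
    proof (rule interleaved_not_convergent[OF disj])
      show "fst (x n) < snd (x n)" for n using good[of n] unfolding good_def by blast
      show "snd (x n) < fst (x (Suc n))" for n using good[of "Suc n"] unfolding good_def by blast
    qed
    moreover have "(\<Inter>n. U n `` {x n}) \<noteq> {}"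
    proof -
      obtain p where p: "good (range U) {} p" using ex[of "range U" "{}"] by auto
      have "good (U ` {..n}) {} p" for n using p unfolding good_def by blast
      then have "(x n, p) \<in> U n" for n using close by blast
      then show ?thesis by blast
    qed
    ultimately show ?thesis by (simp add: proximal_win1_def ut)
  qed
  then show ?thesis unfolding proximal_player2_has_winning_strategy_def by blast
qed

section \<open>Covers played by player 1 in the topological game\<close>

text \<open>
  The cell of \<open>x\<close> in the partition of \<open>\<omega>\<^sub>1\<close> generated by the initial segments \<open>{..g}\<close>
  with \<open>g \<in> F\<close>. These segments are clopen, so cells are open for finite \<open>F\<close>.
\<close>

definition cell :: "omega1 set \<Rightarrow> omega1 \<Rightarrow> omega1 set" where
  "cell F x = {y. \<forall>g\<in>F. y \<le> g \<longleftrightarrow> x \<le> g}"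

lemma open_cell:
  assumes "finite F"
  shows "open (cell F x)"
proof -
  have "open {y. y \<le> g \<longleftrightarrow> x \<le> g}" for g
  proof (cases "x \<le> g")
    case True
    then have "{y. y \<le> g \<longleftrightarrow> x \<le> g} = {..g}" by auto
    then show ?thesis by (simp add: open_atMost_omega1)
  next
    case False
    then have "{y. y \<le> g \<longleftrightarrow> x \<le> g} = {g<..}" by auto
    then show ?thesis by simp
  qed
  moreover have "cell F x = (\<Inter>g\<in>F. {y. y \<le> g \<longleftrightarrow> x \<le> g})" by (auto simp: cell_def)
  ultimately show ?thesis using assms by (simp add: open_INT)
qed

text \<open>
  The covers of \<open>A \<times> B\<close> played by player 1. Since \<open>A\<close> and \<open>B\<close> are disjoint, the cut at
  \<open>min a b\<close> separates the two sides of the rectangle around \<open>(a, b)\<close>, so the rectangle does not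
  meet the diagonal.
\<close>

definition cell_cover :: "omega1 set \<Rightarrow> omega1 set \<Rightarrow> omega1 set \<Rightarrow> (omega1 \<times> omega1) set set" where
  "cell_cover A B F = {(A \<inter> cell (insert (min a b) F) a) \<times> (B \<inter> cell (insert (min a b) F) b) |
     a b. a \<in> A \<and> b \<in> B}"

lemma open_cover_cell_cover:
  assumes "finite F"
  shows "open_cover (rect_top A B) (cell_cover A B F)"
  unfolding open_cover_def
proof
  have "openin (rect_top A B) ((A \<inter> cell G a) \<times> (B \<inter> cell G b))" if "finite G" for G a b
    using that by (subst openin_prod_Times_iff) (simp add: openin_open_Int open_cell)
  then show "\<forall>C\<in>cell_cover A B F. openin (rect_top A B) C"
    unfolding cell_cover_def using assms by blast
  have "(a, b) \<in> \<Union> (cell_cover A B F)" if "a \<in> A" "b \<in> B" for a b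
    using that unfolding cell_cover_def cell_def by blast
  then show "\<Union> (cell_cover A B F) = topspace (rect_top A B)"
    by (auto simp: cell_cover_def)
qed

text \<open>
  Points in a common rectangle are not separated by \<open>F\<close> in either coordinate, and lie on the same
  side of the diagonal with disjoint ranges of coordinates.
\<close>

lemma St_cell_coverD:
  assumes disj: "A \<inter> B = {}" and p: "q \<in> St p (cell_cover A B F)"
  shows "\<And>g. g \<in> F \<Longrightarrow> fst p \<le> g \<longleftrightarrow> fst q \<le> g"
    and "\<And>g. g \<in> F \<Longrightarrow> snd p \<le> g \<longleftrightarrow> snd q \<le> g"
    and "(fst p < snd p \<and> fst q < snd p \<and> fst q < snd q) \<or>
      (snd p < fst p \<and> snd q < fst p \<and> snd q < fst q)"
proof -
  obtain a b where ab: "a \<in> A" "b \<in> B"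
    and in_cell: "fst p \<in> cell (insert (min a b) F) a" "snd p \<in> cell (insert (min a b) F) b"
      "fst q \<in> cell (insert (min a b) F) a" "snd q \<in> cell (insert (min a b) F) b"
    using p unfolding St_def cell_cover_def by fastforce
  show "\<And>g. g \<in> F \<Longrightarrow> fst p \<le> g \<longleftrightarrow> fst q \<le> g" "\<And>g. g \<in> F \<Longrightarrow> snd p \<le> g \<longleftrightarrow> snd q \<le> g"
    using in_cell by (auto simp: cell_def)
  have "a \<noteq> b" using ab disj by blast
  then show "(fst p < snd p \<and> fst q < snd p \<and> fst q < snd q) \<or>
      (snd p < fst p \<and> snd q < fst p \<and> snd q < fst q)"
    using in_cell by (auto simp: cell_def min_def not_le split: if_splits)
qed

text \<open>
  If \<open>d\<close> enumerates the ordinals below \<open>\<delta>\<close>, all \<open>x n\<close> are below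
  \<open>\<delta>\<close>, and no \<open>d k\<close> with \<open>k \<le> n\<close> separates \<open>x n\<close>
  from \<open>l\<close>, then \<open>x\<close> converges to \<open>l\<close> when \<open>l < \<delta>\<close>, and to \<open>\<delta>\<close> otherwise.
\<close>

lemma tendsto_of_separation:
  fixes x :: "nat \<Rightarrow> omega1"
  assumes d: "range d = {..<\<delta>}" and x: "\<And>n. x n < \<delta>"
    and sep: "\<And>n g. g \<in> d ` {..n} \<Longrightarrow> x n \<le> g \<longleftrightarrow> l \<le> g"
  shows "x \<longlonglongrightarrow> min l \<delta>"
proof (rule order_tendstoI)
  have ev: "\<forall>\<^sub>F n in sequentially. x n \<le> g \<longleftrightarrow> l \<le> g" if g: "g < \<delta>" for g
  proof -
    have "g \<in> range d" using d g by simp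
    then obtain k where "g = d k" by blast
    then have "x n \<le> g \<longleftrightarrow> l \<le> g" if "n \<ge> k" for n using that sep[of g n] by auto
    then show ?thesis unfolding eventually_sequentially by blast
  qed
  show "\<forall>\<^sub>F n in sequentially. g < x n" if "g < min l \<delta>" for g
    using ev[of g] that by (auto elim!: eventually_mono)
  show "\<forall>\<^sub>F n in sequentially. x n < g" if "min l \<delta> < g" for g
  proof (cases "l < \<delta>")
    case True
    then show ?thesis using ev[of l] that by (auto elim!: eventually_mono)
  next
    case False
    then have "\<delta> < g" using that by (simp add: min_def split: if_splits)
    then show ?thesis using x less_trans by (intro always_eventually) blast
  qed
qed

section \<open>Player 2 does not win the topological game\<close>

text \<open>The points chosen by the strategy \<open>\<sigma>\<close> against the moves \<open>m\<close> of player 1.\<close>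

fun play :: "('m list \<Rightarrow> 'a list \<Rightarrow> 'a) \<Rightarrow> (nat \<Rightarrow> 'm) \<Rightarrow> nat \<Rightarrow> 'a" where
  "play \<sigma> m n = \<sigma> (map m [0..<Suc n]) (map (play \<sigma> m) [0..<n])"

declare play.simps [simp del]

lemma run_play: "run_of_strategy2 \<sigma> m (play \<sigma> m)"
  unfolding run_of_strategy2_def using play.simps by blast

lemma play_cong:
  assumes "\<And>i. i \<le> n \<Longrightarrow> m i = m' i"
  shows "play \<sigma> m n = play \<sigma> m' n"
  using assms
proof (induction n rule: less_induct)
  case (less n)
  have past: "map (play \<sigma> m) [0..<n] = map (play \<sigma> m') [0..<n]"
    by (rule map_cong[OF refl], rule less.IH) (use less.prems in auto)
  have moves: "map m [0..<Suc n] = map m' [0..<Suc n]"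
    by (rule map_cong[OF refl], rule less.prems) auto
  show ?case by (simp only: play.simps[of \<sigma> m n] play.simps[of \<sigma> m' n] past moves)
qed

text \<open>
  Suppose that player 1 names one ordinal \<open>d i\<close> in each inning and plays the move \<open>K\<close>
  associated with the set of ordinals named so far. As there are only countably many finite lists of
  ordinals below a given one, arbitrarily large \<open>\<delta> \<in> S\<close> have the property that the answers
  stay below \<open>\<delta>\<close> as long as the ordinals named do.
\<close>

lemma strategy_closure_point:
  fixes \<sigma> :: "'m list \<Rightarrow> (omega1 \<times> omega1) list \<Rightarrow> omega1 \<times> omega1" and K :: "omega1 set \<Rightarrow> 'm"
  assumes S: "stationary S"
  shows "\<exists>\<delta>\<in>S. c < \<delta> \<and> (\<forall>d n. range d \<subseteq> {..<\<delta>} \<longrightarrow>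
    fst (play \<sigma> (\<lambda>i. K (d ` {..i})) n) < \<delta> \<and> snd (play \<sigma> (\<lambda>i. K (d ` {..i})) n) < \<delta>)"
proof -
  \<comment> \<open>The last answer when the ordinals in the nonempty list \<open>ds\<close> have been named in turn.\<close>
  define r where "r ds = play \<sigma> (\<lambda>i. K (set (take (Suc i) ds))) (length ds - 1)" for ds
  have r: "play \<sigma> (\<lambda>i. K (d ` {..i})) n = r (map d [0..<Suc n])" for d n
  proof -
    have "set (take (Suc i) (map d [0..<Suc n])) = d ` {..i}" if "i \<le> n" for i
      using that by (simp add: take_map take_upt atLeast0LessThan lessThan_Suc_atMost del: upt_Suc)
    then show ?thesis unfolding r_def by (simp del: upt_Suc) (rule play_cong, simp del: upt_Suc)
  qed
  have "\<exists>s. \<forall>y\<in>(\<lambda>ds. fst (r ds)) ` lists {..g} \<union> (\<lambda>ds. snd (r ds)) ` lists {..g}. y < s"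
    for g
    by (rule omega1_countable_bounded) (simp add: countable_atMost_omega1)
  then obtain h where h: "\<And>g ds. ds \<in> lists {..g} \<Longrightarrow> fst (r ds) < h g \<and> snd (r ds) < h g"
    by (metis (no_types, lifting) UnI1 UnI2 image_eqI)
  obtain \<delta> where \<delta>: "\<delta> \<in> S" "c < \<delta>" "\<And>g. g < \<delta> \<Longrightarrow> h g < \<delta>"
    using stationary_closure_point[OF S] by metis
  have "fst (r (map d [0..<Suc n])) < \<delta> \<and> snd (r (map d [0..<Suc n])) < \<delta>" if "range d \<subseteq> {..<\<delta>}" for d n
  proof -
    define g where "g = Max (d ` {..n})"
    have "g \<in> d ` {..n}" unfolding g_def by (rule Max_in) auto
    then have "h g < \<delta>" using that \<delta>(3) by blast
    moreover have "d i \<le> g" if "i \<le> n" for i unfolding g_def using that by (intro Max_ge) auto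
    then have "map d [0..<Suc n] \<in> lists {..g}"
      by (auto simp: less_Suc_eq_le simp del: upt_Suc)
    ultimately show ?thesis using h less_trans by blast
  qed
  then show ?thesis using \<delta>(1,2) by (intro bexI[of _ \<delta>]) (simp_all add: r del: upt_Suc)
qed

lemma TP_player2_loses:
  assumes A: "stationary A" and B: "stationary B" and disj: "A \<inter> B = {}"
  shows "\<not> TP_player2_has_winning_strategy (rect_top A B)"
proof
  assume "TP_player2_has_winning_strategy (rect_top A B)"
  then obtain \<sigma> where \<sigma>: "\<And>\<C> x. TP_legal1 (rect_top A B) \<C> \<Longrightarrow> run_of_strategy2 \<sigma> \<C> x \<Longrightarrow>
      TP_legal2 (rect_top A B) \<C> x \<and> \<not> TP_win1 (rect_top A B) \<C> x"
    unfolding TP_player2_has_winning_strategy_def by blast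
  let ?K = "cell_cover A B"
  \<comment> \<open>The first move must not depend on \<open>\<delta>\<close>, as \<open>\<delta>\<close> is chosen according to the answer \<open>p\<close>.\<close>
  define z :: omega1 where "z = (LEAST x. True)"
  define p where "p = \<sigma> [?K {z}] []"
  have "stationary (if fst p < snd p then B else A)" using A B by simp
  from strategy_closure_point[OF this, of z \<sigma> ?K]
  obtain \<delta> where \<delta>: "\<delta> \<in> (if fst p < snd p then B else A)" "z < \<delta>"
    "\<forall>d n. range d \<subseteq> {..<\<delta>} \<longrightarrow> fst (play \<sigma> (\<lambda>i. ?K (d ` {..i})) n) < \<delta> \<and>
       snd (play \<sigma> (\<lambda>i. ?K (d ` {..i})) n) < \<delta>"
    by blast
  define d where "d = case_nat z (from_nat_into {..<\<delta>})"
  have ne: "{..<\<delta>} \<noteq> {}" using \<delta> by auto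
  have "range d = {..<\<delta>}"
  proof -
    have "range d = insert z (range (from_nat_into {..<\<delta>}))"
      unfolding d_def by (auto simp: image_iff split: nat.splits)
    also have "\<dots> = {..<\<delta>}"
      using range_from_nat_into[OF ne countable_lessThan_omega1] \<delta> by auto
    finally show ?thesis .
  qed
  note d = this
  define \<C> where "\<C> n = ?K (d ` {..n})" for n
  define x where "x = play \<sigma> \<C>"
  have x0: "x 0 = p" by (simp add: x_def play.simps \<C>_def p_def d_def)
  have below: "fst (x n) < \<delta>" "snd (x n) < \<delta>" for n
    using \<delta>(3) d unfolding x_def \<C>_def by simp_all
  have "TP_legal1 (rect_top A B) \<C>"
    unfolding TP_legal1_def \<C>_def by (intro allI open_cover_cell_cover) simp
  from \<sigma>[OF this run_play] have legal: "TP_legal2 (rect_top A B) \<C> x"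
    and nconv: "\<not> converges_in (rect_top A B) x" and ne: "(\<Inter>n. St (x n) (\<C> n)) \<noteq> {}"
    unfolding x_def TP_win1_def by blast+
  obtain q where q: "\<And>n. q \<in> St (x n) (\<C> n)" using ne by blast
  have mem: "x n \<in> A \<times> B" for n using legal by (auto simp: TP_legal2_def)
  note qD = St_cell_coverD[OF disj q[unfolded \<C>_def]]
  have qAB: "q \<in> A \<times> B" using q[of 0] by (auto simp: St_def \<C>_def cell_cover_def)
  \<comment> \<open>The point \<open>q\<close> witnesses that the stars have a common point; it yields a limit of \<open>x\<close>.\<close>
  have "(\<lambda>n. fst (x n)) \<longlonglongrightarrow> min (fst q) \<delta>" "(\<lambda>n. snd (x n)) \<longlonglongrightarrow> min (snd q) \<delta>"
    by (rule tendsto_of_separation[OF d]; use below qD(1,2) in simp)+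
  moreover have "min (fst q) \<delta> \<in> A \<and> min (snd q) \<delta> \<in> B"
  proof (cases "fst p < snd p")
    case True
    then have "fst q < snd (x 0)" using qD(3)[of 0] x0 by auto
    then have "fst q < \<delta>" using below less_trans by blast
    then show ?thesis using qAB \<delta>(1) True by (auto simp: min_def)
  next
    case False
    then have "snd q < fst (x 0)" using qD(3)[of 0] x0 by auto
    then have "snd q < \<delta>" using below less_trans by blast
    then show ?thesis using qAB \<delta>(1) False by (auto simp: min_def)
  qed
  ultimately have "limitin (rect_top A B) x (min (fst q) \<delta>, min (snd q) \<delta>) sequentially"
    unfolding limitin_pairwise limitin_subtopology using mem by (simp add: o_def mem_Times_iff)
  then show False using nconv unfolding converges_in_def by blast
qed

theorem theorem7p2:
  fixes A B :: "omega1 set" and T :: "(omega1 \<times> omega1) topology"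
  assumes "stationary A" and "stationary B" and "A \<inter> B = {}"
  defines "T \<equiv> prod_topology (subtopology euclidean A) (subtopology euclidean B)"
  shows "(\<forall>\<UU>. compatible_uniformity T \<UU> \<longrightarrow>
            proximal_player2_has_winning_strategy (A \<times> B) \<UU>) \<and>
         \<not> TP_player2_has_winning_strategy T"
  using proximal_player2_wins TP_player2_loses assms(1-3) unfolding T_def by blast

end
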